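(* Let $n$ be a positive integer. The inner automorphism group $\mathrm{Inn}(R_n)$ of the dihedral quandle $R_n$ is isomorphic to the dihedral group $D_{m/2}$ of order $m$, where $m$ is the least common multiple of $n$ and $2$.
   Context: $\mathbb{Z}_n$ denotes the integers modulo $n$. A quandle is a set $X$ with a binary operation $*$ such that: (1) $a*a=a$ for all $a\in X$; (2) for all $a,b\in X$ there is a unique $x\in X$ with $a=x*b$; (3) $(a*b)*c=(a*c)*(b*c)$ for all $a,b,c\in X$. For a positive integer $n$, the dihedral quandle $R_n$ is the set $\mathbb{Z}_n$ with the operation $i*j=2j-i \pmod n$. For a quandle $X$ and $u\in X$, the symmetry $S_u:X\to X$ is the map $S_u(x)=x*u$; it is a bijection and a quandle homomorphism (i.e. $S_u(a*b)=S_u(a)*S_u(b)$ for all $a,b\in X$). $\mathrm{Aut}(X)$ denotes the group, under composition, of automorphisms of the quandle $X$ (bijective quandle homomorphisms $X\to X$). The inner automorphism group $\mathrm{Inn}(X)$ is the subgroup of $\mathrm{Aut}(X)$ generated by all symmetries $S_u$, $u\in X$. $D_k$ denotes the dihedral group of order $2k$.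
   Formalization: The formal theorem assumes n ≥ 3 instead of n positive: for n = 1 and n = 2 every symmetry of R_n is the identity, so Inn(R_n) is trivial, while m = 2 and D_1 has order 2, so the claim as stated fails in exactly those two cases. *)

theory Defs
  imports "HOL-Algebra.Elementary_Groups" "HOL-Algebra.Bij"
begin

section \<open>Quandles\<close>

record 'a magma = "'a partial_object" +
  star :: "['a, 'a] \<Rightarrow> 'a"  (infixl "\<star>\<index>" 70)

locale quandle =
  fixes X :: "('a, 'b) magma_scheme" (structure)
  assumes star_closed: "\<lbrakk>a \<in> carrier X; b \<in> carrier X\<rbrakk> \<Longrightarrow> a \<star> b \<in> carrier X"
    and star_idem: "a \<in> carrier X \<Longrightarrow> a \<star> a = a"
    and star_div: "\<lbrakk>a \<in> carrier X; b \<in> carrier X\<rbrakk> \<Longrightarrow> \<exists>!x. x \<in> carrier X \<and> a = x \<star> b"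
    and star_distrib: "\<lbrakk>a \<in> carrier X; b \<in> carrier X; c \<in> carrier X\<rbrakk>
      \<Longrightarrow> (a \<star> b) \<star> c = (a \<star> c) \<star> (b \<star> c)"

text \<open>As in \<^theory>\<open>HOL-Algebra.Bij\<close>, self-maps of a quandle are represented by
  extensional functions, so that two maps are equal iff they agree on the carrier.\<close>

definition quandle_auto :: "('a, 'b) magma_scheme \<Rightarrow> ('a \<Rightarrow> 'a) set" where
  "quandle_auto X = {f \<in> Bij (carrier X).
     \<forall>a \<in> carrier X. \<forall>b \<in> carrier X. f (a \<star>\<^bsub>X\<^esub> b) = f a \<star>\<^bsub>X\<^esub> f b}"

definition quandle_Aut :: "('a, 'b) magma_scheme \<Rightarrow> ('a \<Rightarrow> 'a) monoid" where
  "quandle_Aut X = BijGroup (carrier X) \<lparr>carrier := quandle_auto X\<rparr>"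

definition quandle_sym :: "('a, 'b) magma_scheme \<Rightarrow> 'a \<Rightarrow> 'a \<Rightarrow> 'a" where
  "quandle_sym X u = (\<lambda>x \<in> carrier X. x \<star>\<^bsub>X\<^esub> u)"

definition quandle_Inn :: "('a, 'b) magma_scheme \<Rightarrow> ('a \<Rightarrow> 'a) monoid" where
  "quandle_Inn X = subgroup_generated (quandle_Aut X) (quandle_sym X ` carrier X)"

text \<open>\<^const>\<open>subgroup_generated\<close> intersects the generating set with the carrier of the ambient
  group. The lemma \<open>quandle_sym_auto\<close> below shows that nothing is lost.\<close>

lemma quandle_autoD:
  assumes "f \<in> quandle_auto X"
  shows "f \<in> Bij (carrier X)" "f \<in> carrier X \<rightarrow> carrier X"
    "\<And>a b. \<lbrakk>a \<in> carrier X; b \<in> carrier X\<rbrakk> \<Longrightarrow> f (a \<star>\<^bsub>X\<^esub> b) = f a \<star>\<^bsub>X\<^esub> f b"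
  using assms by (auto simp: quandle_auto_def dest: Bij_imp_funcset)

context quandle
begin

lemma subgroup_quandle_auto: "subgroup (quandle_auto X) (BijGroup (carrier X))"
proof (rule subgroup.intro)
  show "quandle_auto X \<subseteq> carrier (BijGroup (carrier X))"
    by (auto simp: quandle_auto_def BijGroup_def)
next
  fix f g assume f: "f \<in> quandle_auto X" and g: "g \<in> quandle_auto X"
  have "compose (carrier X) f g \<in> quandle_auto X"
    using quandle_autoD[OF f] quandle_autoD[OF g] star_closed
    by (auto simp: quandle_auto_def compose_Bij compose_eq Pi_iff)
  then show "f \<otimes>\<^bsub>BijGroup (carrier X)\<^esub> g \<in> quandle_auto X"
    using quandle_autoD(1)[OF f] quandle_autoD(1)[OF g] by (simp add: BijGroup_def)
next
  show "\<one>\<^bsub>BijGroup (carrier X)\<^esub> \<in> quandle_auto X"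
    using star_closed by (auto simp: BijGroup_def quandle_auto_def id_Bij)
next
  fix f assume f: "f \<in> quandle_auto X"
  have "(\<lambda>x \<in> carrier X. inv_into (carrier X) f x) \<in> quandle_auto X"
    using quandle_autoD[OF f] star_closed
    by (auto simp: quandle_auto_def restrict_inv_into_Bij intro!: Bij_inv_into_lemma)
  then show "inv\<^bsub>BijGroup (carrier X)\<^esub> f \<in> quandle_auto X"
    using quandle_autoD(1)[OF f] by (simp add: inv_BijGroup)
qed

lemma group_quandle_Aut: "group (quandle_Aut X)"
  unfolding quandle_Aut_def
  using subgroup_quandle_auto group_BijGroup by (rule subgroup.subgroup_is_group)

lemma quandle_sym_auto:
  assumes u: "u \<in> carrier X"
  shows "quandle_sym X u \<in> carrier (quandle_Aut X)"
proof -
  have "bij_betw (\<lambda>x. x \<star> u) (carrier X) (carrier X)"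
  proof (rule bij_betw_imageI)
    show "inj_on (\<lambda>x. x \<star> u) (carrier X)"
      using star_div[OF star_closed u] u by (intro inj_onI) metis
    show "(\<lambda>x. x \<star> u) ` carrier X = carrier X"
    proof
      show "(\<lambda>x. x \<star> u) ` carrier X \<subseteq> carrier X" using star_closed u by auto
      show "carrier X \<subseteq> (\<lambda>x. x \<star> u) ` carrier X" using star_div[OF _ u] by blast
    qed
  qed
  then have "bij_betw (quandle_sym X u) (carrier X) (carrier X)"
    by (simp add: quandle_sym_def cong: bij_betw_cong)
  moreover have "quandle_sym X u (a \<star> b) = quandle_sym X u a \<star> quandle_sym X u b"
    if "a \<in> carrier X" "b \<in> carrier X" for a b
    using that star_closed[OF that] star_distrib[OF that u] by (simp add: quandle_sym_def)
  ultimately show ?thesis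
    by (simp add: quandle_Aut_def quandle_auto_def Bij_def) (simp add: quandle_sym_def)
qed

lemma group_quandle_Inn: "group (quandle_Inn X)"
  unfolding quandle_Inn_def
  by (rule group.group_subgroup_generated[OF group_quandle_Aut])

end


section \<open>Dihedral quandles and dihedral groups\<close>

definition dihedral_quandle :: "nat \<Rightarrow> int magma" where
  "dihedral_quandle n =
     \<lparr>carrier = carrier (integer_mod_group n), star = (\<lambda>i j. (2 * j - i) mod int n)\<rparr>"

lemma quandle_dihedral_quandle:
  assumes "n > 0"
  shows "quandle (dihedral_quandle n)"
proof
  fix a b c
  assume a: "a \<in> carrier (dihedral_quandle n)" and b: "b \<in> carrier (dihedral_quandle n)"
  show "\<exists>!x. x \<in> carrier (dihedral_quandle n) \<and> a = x \<star>\<^bsub>dihedral_quandle n\<^esub> b"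
  proof (intro ex1I[of _ "(2 * b - a) mod int n"] conjI)
    show "a = (2 * b - a) mod int n \<star>\<^bsub>dihedral_quandle n\<^esub> b"
      using a assms
      by (simp add: dihedral_quandle_def carrier_integer_mod_group mod_diff_right_eq)
  qed (use assms b in \<open>auto simp: dihedral_quandle_def carrier_integer_mod_group mod_diff_right_eq\<close>)
  show "(a \<star>\<^bsub>dihedral_quandle n\<^esub> b) \<star>\<^bsub>dihedral_quandle n\<^esub> c =
    (a \<star>\<^bsub>dihedral_quandle n\<^esub> c) \<star>\<^bsub>dihedral_quandle n\<^esub> (b \<star>\<^bsub>dihedral_quandle n\<^esub> c)"
  proof -
    have "(2 * c - (2 * b - a) mod int n) mod int n = (2 * (2 * c - b) - (2 * c - a)) mod int n"
      by (simp add: mod_diff_right_eq algebra_simps)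
    also have "\<dots> = (2 * ((2 * c - b) mod int n) - (2 * c - a) mod int n) mod int n"
      by (intro mod_diff_cong) (simp_all add: mod_mult_right_eq)
    finally show ?thesis by (simp add: dihedral_quandle_def)
  qed
qed (use assms in \<open>auto simp: dihedral_quandle_def carrier_integer_mod_group\<close>)

text \<open>The pair \<open>(a, False)\<close> is the rotation \<open>r ^ a\<close> and \<open>(a, True)\<close> is the reflection
  \<open>r ^ a s\<close>, where \<open>r ^ k = s\<^sup>2 = 1\<close> and \<open>s r = r\<inverse> s\<close>; that is, the dihedral group
  is the semidirect product of the integers modulo \<open>k\<close> with a group of order two acting by
  negation. It has order \<open>2 * k\<close> for all \<open>k > 0\<close>, including \<open>k = 1\<close> and \<open>k = 2\<close>.\<close>

definition dihedral_group :: "nat \<Rightarrow> (int \<times> bool) monoid" where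
  "dihedral_group k =
     \<lparr>carrier = carrier (integer_mod_group k) \<times> UNIV,
      mult = (\<lambda>(a, s) (b, t). ((if s then a - b else a + b) mod int k, s \<noteq> t)),
      one = (0, False)\<rparr>"

lemma group_dihedral_group:
  assumes "k > 0"
  shows "group (dihedral_group k)"
proof (rule groupI)
  fix x assume x: "x \<in> carrier (dihedral_group k)"
  obtain a s where [simp]: "x = (a, s)" by (cases x)
  let ?y = "(if s then a else (- a) mod int k, s)"
  have "?y \<in> carrier (dihedral_group k)" "?y \<otimes>\<^bsub>dihedral_group k\<^esub> x = \<one>\<^bsub>dihedral_group k\<^esub>"
    using x assms by (auto simp: dihedral_group_def carrier_integer_mod_group mod_simps)
  then show "\<exists>y \<in> carrier (dihedral_group k). y \<otimes>\<^bsub>dihedral_group k\<^esub> x = \<one>\<^bsub>dihedral_group k\<^esub>"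
    by blast
qed (use assms in \<open>auto simp: dihedral_group_def carrier_integer_mod_group mod_simps algebra_simps
      split: if_splits\<close>)

lemma order_dihedral_group:
  assumes "k > 0"
  shows "order (dihedral_group k) = 2 * k"
  using assms
  by (simp add: order_def dihedral_group_def carrier_integer_mod_group card_cartesian_product)

text \<open>For \<open>n = 1\<close> and \<open>n = 2\<close> every symmetry of the dihedral quandle is the identity, so the
  inner automorphism group is trivial, whereas \<open>lcm n 2 = 2\<close>.\<close>

lemma quandle_Inn_dihedral_quandle_small:
  assumes "n = 1 \<or> n = 2"
  shows "trivial_group (quandle_Inn (dihedral_quandle n))"
    and "order (dihedral_group (lcm n 2 div 2)) = 2"
    and "\<not> quandle_Inn (dihedral_quandle n) \<cong> dihedral_group (lcm n 2 div 2)"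
proof -
  have n: "n > 0" using assms by auto
  interpret quandle "dihedral_quandle n" by (rule quandle_dihedral_quandle[OF n])
  have "(2 * u - x) mod int n = x" if "x \<in> carrier (integer_mod_group n)" for u x
    using that assms by (auto simp: carrier_integer_mod_group) presburger
  then have "quandle_sym (dihedral_quandle n) u = \<one>\<^bsub>quandle_Aut (dihedral_quandle n)\<^esub>" for u
    by (auto simp: quandle_sym_def quandle_Aut_def BijGroup_def dihedral_quandle_def restrict_def)
  then show 1: "trivial_group (quandle_Inn (dihedral_quandle n))"
    unfolding quandle_Inn_def
    by (intro group.trivial_group_subgroup_generated[OF group_quandle_Aut]) auto
  have "lcm n 2 div 2 = 1" using assms by auto
  then show 2: "order (dihedral_group (lcm n 2 div 2)) = 2"
    by (simp add: order_dihedral_group)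
  show "\<not> quandle_Inn (dihedral_quandle n) \<cong> dihedral_group (lcm n 2 div 2)"
  proof
    assume "quandle_Inn (dihedral_quandle n) \<cong> dihedral_group (lcm n 2 div 2)"
    then have "order (quandle_Inn (dihedral_quandle n)) = 2"
      using 2 iso_same_card by (fastforce simp: order_def)
    with 1 show False by (auto simp: trivial_group_def order_def)
  qed
qed

end

theory Submission
  imports Defs
begin

text \<open>Let \<open>k = lcm n 2 div 2\<close>. Since \<open>2 * a\<close> modulo \<open>n\<close> determines and is determined by \<open>a\<close>
  modulo \<open>k\<close>, the dihedral group of order \<open>2 * k\<close> acts on the dihedral quandle of order \<open>n\<close>, with
  \<open>r ^ a\<close> acting as \<open>x \<mapsto> 2 * a + x\<close> and \<open>r ^ a s\<close> as \<open>x \<mapsto> 2 * a - x\<close>. The reflections act as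
  precisely the symmetries of the quandle, and they generate the group, so the image of the action
  is the inner automorphism group. For \<open>n \<ge> 3\<close> the action is faithful, because a rotation and a
  reflection cannot agree on both \<open>0\<close> and \<open>1\<close>.\<close>

text \<open>Restriction to the carrier makes the values extensional, as elements of
  \<open>BijGroup\<close> must be. The index \<open>a\<close> may be any integer, so composites can
  be computed before reducing it.\<close>

definition dihedral_action :: "nat \<Rightarrow> int \<times> bool \<Rightarrow> int \<Rightarrow> int" where
  "dihedral_action n = (\<lambda>(a, s). \<lambda>x \<in> carrier (integer_mod_group n).
     (2 * a + (if s then - x else x)) mod int n)"

text \<open>Doubling both sides turns the divisor into \<open>lcm n 2\<close>; as
  \<open>2 * c\<close> is even anyway, only divisibility by \<open>n\<close> remains. This avoids a
  case split on the parity of \<open>n\<close>.\<close>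

lemma half_lcm_dvd_iff: "int (lcm n 2 div 2) dvd c \<longleftrightarrow> int n dvd 2 * c"
proof -
  have "2 * int (lcm n 2 div 2) = int (lcm n 2)"
    by (metis dvd_lcm2 dvd_mult_div_cancel of_nat_mult of_nat_numeral)
  then have "int (lcm n 2 div 2) dvd c \<longleftrightarrow> int (lcm n 2) dvd 2 * c"
    by (metis dvd_mult_cancel_left zero_neq_numeral)
  also have "int (lcm n 2) = lcm (int n) 2"
    by (metis lcm_int_int_eq of_nat_numeral)
  finally show ?thesis by simp
qed

lemma half_lcm_mod_eq_iff:
  "a mod int (lcm n 2 div 2) = b mod int (lcm n 2 div 2) \<longleftrightarrow> (2 * a) mod int n = (2 * b) mod int n"
  by (simp add: mod_eq_dvd_iff half_lcm_dvd_iff right_diff_distrib)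

lemma half_lcm_pos: "n > 0 \<Longrightarrow> lcm n 2 div 2 > (0::nat)"
  using dvd_imp_le[OF dvd_lcm2[of 2 n]] lcm_pos_nat[of n 2] by (simp add: div_greater_zero_iff)

lemma half_lcm_le: "n > 0 \<Longrightarrow> lcm n 2 div 2 \<le> (n::nat)"
  using dvd_imp_le[OF lcm_least[of n "2 * n" 2]] by simp

lemma dihedral_action_reflection:
  "dihedral_action n (a, True) = quandle_sym (dihedral_quandle n) a"
  by (simp add: dihedral_action_def quandle_sym_def dihedral_quandle_def)

lemma dihedral_action_cong:
  assumes "(2 * a) mod int n = (2 * b) mod int n"
  shows "dihedral_action n (a, s) = dihedral_action n (b, s)"
  unfolding dihedral_action_def using mod_add_cong[OF assms refl] by (auto intro!: restrict_ext)

lemma dihedral_action_compose: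
  assumes "n > 0"
  shows "compose (carrier (integer_mod_group n)) (dihedral_action n (a, s)) (dihedral_action n (b, t)) =
    dihedral_action n (if s then a - b else a + b, s \<noteq> t)"
  using assms
  by (auto simp: dihedral_action_def compose_def carrier_integer_mod_group mod_simps algebra_simps
      intro!: restrict_ext)

lemma generate_reflections_dihedral_group:
  assumes "k > 0"
  shows "generate (dihedral_group k) (carrier (integer_mod_group k) \<times> {True}) =
    carrier (dihedral_group k)"
    (is "generate ?D ?R = _")
proof
  interpret group ?D by (rule group_dihedral_group[OF assms])
  show "generate ?D ?R \<subseteq> carrier ?D"
    by (rule generate_incl) (auto simp: dihedral_group_def)
  show "carrier ?D \<subseteq> generate ?D ?R"
  proof
    fix x assume "x \<in> carrier ?D"
    then obtain a s where x: "x = (a, s)" and a: "a \<in> carrier (integer_mod_group k)"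
      by (auto simp: dihedral_group_def)
    have a_in: "(a, True) \<in> generate ?D ?R" and zero_in: "(0, True) \<in> generate ?D ?R"
      using a assms by (auto intro!: generate.incl simp: carrier_integer_mod_group)
    \<comment> \<open>Each rotation is a product of two reflections:
      \<open>r ^ a = (r ^ a s) s\<close>.\<close>
    have "(a, True) \<otimes>\<^bsub>?D\<^esub> (0, True) = (a, False)"
      using a assms by (auto simp: dihedral_group_def carrier_integer_mod_group)
    with generate.eng[OF a_in zero_in] a_in show "x \<in> generate ?D ?R"
      by (cases s) (simp_all add: x)
  qed
qed

lemma mult_quandle_Aut:
  assumes "f \<in> carrier (quandle_Aut X)" "g \<in> carrier (quandle_Aut X)"
  shows "f \<otimes>\<^bsub>quandle_Aut X\<^esub> g = compose (carrier X) f g"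
  using assms by (simp add: quandle_Aut_def BijGroup_def quandle_auto_def)

lemma dihedral_action_hom:
  assumes n: "n > 0"
  shows "dihedral_action n \<in> hom (dihedral_group (lcm n 2 div 2)) (quandle_Aut (dihedral_quandle n))"
    (is "_ \<in> hom (dihedral_group ?k) (quandle_Aut ?X)")
proof (rule homI)
  interpret quandle ?X by (rule quandle_dihedral_quandle[OF n])
  interpret A: group "quandle_Aut ?X" by (rule group_quandle_Aut)
  have carrier_X: "carrier ?X = carrier (integer_mod_group n)"
    by (simp add: dihedral_quandle_def)
  show closed: "dihedral_action n x \<in> carrier (quandle_Aut ?X)"
    if x_in: "x \<in> carrier (dihedral_group ?k)" for x
  proof -
    obtain a s where x: "x = (a, s)" and "a \<in> carrier (integer_mod_group ?k)"
      using x_in by (auto simp: dihedral_group_def)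
    \<comment> \<open>Since \<open>?k \<le> n\<close>, representatives modulo \<open>?k\<close> are
      themselves points of the quandle and so index symmetries.\<close>
    then have "a \<in> carrier ?X" "0 \<in> carrier ?X"
      using n half_lcm_pos[OF n] half_lcm_le[OF n] by (auto simp: carrier_X carrier_integer_mod_group)
    then have "dihedral_action n (a, True) \<in> carrier (quandle_Aut ?X)"
      "dihedral_action n (0, True) \<in> carrier (quandle_Aut ?X)"
      unfolding dihedral_action_reflection by (auto intro: quandle_sym_auto)
    \<comment> \<open>A rotation is the composite of two symmetries, so it is an automorphism
      without a separate check.\<close>
    with A.m_closed[OF this] show ?thesis
      by (cases s) (simp_all add: x mult_quandle_Aut carrier_X dihedral_action_compose n)
  qed
  fix x y assume xy: "x \<in> carrier (dihedral_group ?k)" "y \<in> carrier (dihedral_group ?k)"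
  obtain a s b t where [simp]: "x = (a, s)" "y = (b, t)" by (metis surj_pair)
  \<comment> \<open>The group product reduces the index modulo \<open>?k\<close>, whereas composing
    maps leaves it unreduced; both indices act alike.\<close>
  have "dihedral_action n (c mod int ?k, s \<noteq> t) = dihedral_action n (c, s \<noteq> t)" for c
    by (rule dihedral_action_cong) (simp flip: half_lcm_mod_eq_iff)
  then show "dihedral_action n (x \<otimes>\<^bsub>dihedral_group ?k\<^esub> y) =
      dihedral_action n x \<otimes>\<^bsub>quandle_Aut ?X\<^esub> dihedral_action n y"
    unfolding mult_quandle_Aut[OF closed[OF xy(1)] closed[OF xy(2)]]
    by (simp add: carrier_X dihedral_action_compose[OF n] dihedral_group_def)
qed

lemma dihedral_action_inj:
  assumes n: "n \<ge> 3"
  shows "inj_on (dihedral_action n) (carrier (dihedral_group (lcm n 2 div 2)))"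
    (is "inj_on _ (carrier (dihedral_group ?k))")
proof (rule inj_onI, clarify)
  fix a s b t
  assume "(a, s) \<in> carrier (dihedral_group ?k)" "(b, t) \<in> carrier (dihedral_group ?k)"
    and eq: "dihedral_action n (a, s) = dihedral_action n (b, t)"
  moreover have "?k > 0" using half_lcm_pos n by simp
  ultimately have ab: "a mod int ?k = a" "b mod int ?k = b"
    by (simp_all add: dihedral_group_def carrier_integer_mod_group)
  \<comment> \<open>At 0 rotations and reflections with the same index agree, so this value
    determines the index alone.\<close>
  have at_0: "(2 * a) mod int n = (2 * b) mod int n"
    using fun_cong[OF eq, of 0] n
    by (simp add: dihedral_action_def carrier_integer_mod_group split: if_splits)
  with ab have "a = b" by (metis half_lcm_mod_eq_iff)
  have at_1: "(2 * a + (if s then - 1 else 1)) mod int n = (2 * b + (if t then - 1 else 1)) mod int n"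
    using fun_cong[OF eq, of 1] n
    by (simp add: dihedral_action_def carrier_integer_mod_group split: if_splits)
  \<comment> \<open>With equal indices but \<open>s \<noteq> t\<close>, the values at 1 would give 1
    congruent to -1 modulo \<open>n\<close>.\<close>
  have "\<not> int n dvd 2" "\<not> int n dvd - 2"
    using n zdvd_imp_le[of "int n" 2] by auto
  with at_1 \<open>a = b\<close> have "s = t"
    by (auto simp: mod_eq_dvd_iff split: if_splits)
  with \<open>a = b\<close> show "a = b \<and> s = t" by simp
qed

text \<open>For even \<open>n\<close> there are only \<open>n div 2\<close> reflections for
  \<open>n\<close> points, but \<open>u\<close> and \<open>u mod ?k\<close> define the same
  symmetry, so none is missed.\<close>

lemma dihedral_action_image_reflections:
  assumes n: "n > 0"
  shows "dihedral_action n ` (carrier (integer_mod_group (lcm n 2 div 2)) \<times> {True}) =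
    quandle_sym (dihedral_quandle n) ` carrier (dihedral_quandle n)"
    (is "_ ` (carrier (integer_mod_group ?k) \<times> _) = quandle_sym ?X ` _")
proof (intro equalityI subsetI)
  fix f assume "f \<in> dihedral_action n ` (carrier (integer_mod_group ?k) \<times> {True})"
  then show "f \<in> quandle_sym ?X ` carrier ?X"
    using n half_lcm_pos[OF n] half_lcm_le[OF n]
    by (auto simp: dihedral_action_reflection dihedral_quandle_def carrier_integer_mod_group)
next
  fix f assume "f \<in> quandle_sym ?X ` carrier ?X"
  then obtain u where "f = dihedral_action n (u, True)"
    by (auto simp: dihedral_action_reflection)
  also have "\<dots> = dihedral_action n (u mod int ?k, True)"
    by (rule dihedral_action_cong) (simp flip: half_lcm_mod_eq_iff)
  finally show "f \<in> dihedral_action n ` (carrier (integer_mod_group ?k) \<times> {True})"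
    using half_lcm_pos[OF n] by (auto simp: carrier_integer_mod_group)
qed

theorem theorem2p3:
  fixes n m :: nat
  assumes "n \<ge> 3"
    and "m = lcm n 2"
  shows "quandle_Inn (dihedral_quandle n) \<cong> dihedral_group (m div 2)"
proof -
  let ?X = "dihedral_quandle n" and ?D = "dihedral_group (lcm n 2 div 2)"
  let ?R = "carrier (integer_mod_group (lcm n 2 div 2)) \<times> {True}"
  have n: "n > 0" using assms by simp
  interpret quandle ?X by (rule quandle_dihedral_quandle[OF n])
  interpret D: group ?D by (rule group_dihedral_group[OF half_lcm_pos[OF n]])
  interpret group_hom ?D "quandle_Aut ?X" "dihedral_action n"
    by (intro group_hom.intro group_hom_axioms.intro D.is_group group_quandle_Aut
        dihedral_action_hom n)
  have "carrier (quandle_Inn ?X) = generate (quandle_Aut ?X) (quandle_sym ?X ` carrier ?X)"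
    using quandle_sym_auto
    by (simp add: quandle_Inn_def carrier_subgroup_generated Int_absorb1 image_subset_iff)
  also have "\<dots> = dihedral_action n ` generate ?D ?R"
    \<comment> \<open>A homomorphism maps the subgroup generated by a set onto the one generated by
      its image.\<close>
    unfolding dihedral_action_image_reflections[OF n, symmetric]
    by (rule generate_img) (auto simp: dihedral_group_def)
  also have "\<dots> = dihedral_action n ` carrier ?D"
    by (simp add: generate_reflections_dihedral_group half_lcm_pos[OF n])
  finally have image: "dihedral_action n ` carrier ?D = carrier (quandle_Inn ?X)" ..
  have "dihedral_action n \<in> iso ?D (quandle_Inn ?X)"
  proof (rule isoI)
    show "dihedral_action n \<in> hom ?D (quandle_Inn ?X)"
      using image by (auto intro!: homI simp: quandle_Inn_def)
    show "bij_betw (dihedral_action n) (carrier ?D) (carrier (quandle_Inn ?X))"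
      using dihedral_action_inj[OF assms(1)] image by (simp add: bij_betw_def)
  qed
  then have "?D \<cong> quandle_Inn ?X" by (rule is_isoI)
  then show ?thesis
    unfolding assms(2) by (rule D.iso_sym)
qed

end
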